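(* Let $n\ge 3$. Every bipartite IC-planar graph with $n$ vertices has at most $2.25n-4$ edges.
   Context: Graphs are simple. A topological drawing places vertices at distinct points and edges as Jordan arcs between their endpoints, such that no edge passes through a vertex other than its endpoints, no two adjacent edges cross, no edge crosses itself, no two edges meet tangentially, and any two edges cross at most once. A graph is IC-planar if it admits such a drawing in which every edge is crossed at most once and no two crossing pairs of edges share an endpoint. *)

theory Defs
  imports "HOL-Analysis.Analysis"
begin

definition simple_graph :: "'a set \<Rightarrow> 'a set set \<Rightarrow> bool" where
  "simple_graph V E \<longleftrightarrow> finite V \<and> (\<forall>e\<in>E. e \<subseteq> V \<and> card e = 2)"

definition bipartite :: "'a set \<Rightarrow> 'a set set \<Rightarrow> bool" where
  "bipartite V E \<longleftrightarrow>
     (\<exists>A B. A \<union> B = V \<and> A \<inter> B = {} \<and> (\<forall>e\<in>E. \<exists>a\<in>A. \<exists>b\<in>B. e = {a, b}))"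

definition path_inner :: "(real \<Rightarrow> complex) \<Rightarrow> complex set" where
  "path_inner g = path_image g - {pathstart g, pathfinish g}"

text \<open>A common inner point \<open>p\<close> of two arcs is a crossing, as opposed to a tangential meeting, if
  near \<open>p\<close> the two arcs look, up to a homeomorphism, like the two coordinate axes near the
  origin.\<close>

definition crossing_at :: "(real \<Rightarrow> complex) \<Rightarrow> (real \<Rightarrow> complex) \<Rightarrow> complex \<Rightarrow> bool" where
  "crossing_at g h p \<longleftrightarrow>
     p \<in> path_inner g \<inter> path_inner h \<and>
     (\<exists>U \<phi> \<psi>. open U \<and> p \<in> U \<and> homeomorphism U (ball 0 1) \<phi> \<psi> \<and> \<phi> p = 0 \<and>
        \<phi> ` (U \<inter> path_image g) = {z \<in> ball 0 1. Im z = 0} \<and>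
        \<phi> ` (U \<inter> path_image h) = {z \<in> ball 0 1. Re z = 0})"

text \<open>The edge \<open>e\<close> is drawn as the arc \<open>\<gamma> e\<close>; its orientation is irrelevant. That no edge crosses
  itself is part of \<^const>\<open>arc\<close>, which demands injectivity.\<close>

locale topological_drawing =
  fixes V :: "'a set" and E :: "'a set set"
    and pos :: "'a \<Rightarrow> complex" and \<gamma> :: "'a set \<Rightarrow> real \<Rightarrow> complex"
  assumes vertices_distinct: "inj_on pos V"
    and edge_arc: "e \<in> E \<Longrightarrow> arc (\<gamma> e)"
    and edge_ends: "e \<in> E \<Longrightarrow> {pathstart (\<gamma> e), pathfinish (\<gamma> e)} = pos ` e"
    and edge_avoids_vertices: "e \<in> E \<Longrightarrow> v \<in> V \<Longrightarrow> v \<notin> e \<Longrightarrow> pos v \<notin> path_image (\<gamma> e)"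
    and adjacent_no_crossing:
      "e \<in> E \<Longrightarrow> f \<in> E \<Longrightarrow> e \<noteq> f \<Longrightarrow> e \<inter> f \<noteq> {} \<Longrightarrow> \<not> crossing_at (\<gamma> e) (\<gamma> f) p"
    and no_tangential_meeting:
      "e \<in> E \<Longrightarrow> f \<in> E \<Longrightarrow> e \<noteq> f \<Longrightarrow> p \<in> path_inner (\<gamma> e) \<inter> path_inner (\<gamma> f) \<Longrightarrow>
         crossing_at (\<gamma> e) (\<gamma> f) p"
    and cross_at_most_once:
      "e \<in> E \<Longrightarrow> f \<in> E \<Longrightarrow> e \<noteq> f \<Longrightarrow> crossing_at (\<gamma> e) (\<gamma> f) p \<Longrightarrow>
         crossing_at (\<gamma> e) (\<gamma> f) q \<Longrightarrow> p = q"

definition crossing_pair :: "'a set set \<Rightarrow> ('a set \<Rightarrow> real \<Rightarrow> complex) \<Rightarrow> 'a set \<Rightarrow> 'a set \<Rightarrow> bool" where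
  "crossing_pair E \<gamma> e f \<longleftrightarrow>
     e \<in> E \<and> f \<in> E \<and> e \<noteq> f \<and> (\<exists>p. crossing_at (\<gamma> e) (\<gamma> f) p)"

text \<open>Within a topological drawing two edges cross at most once, so the crossings of an edge
  correspond to the edges that it crosses.\<close>

definition ic_planar :: "'a set \<Rightarrow> 'a set set \<Rightarrow> bool" where
  "ic_planar V E \<longleftrightarrow>
     (\<exists>pos \<gamma>. topological_drawing V E pos \<gamma> \<and>
        (\<forall>e f g. crossing_pair E \<gamma> e f \<longrightarrow> crossing_pair E \<gamma> e g \<longrightarrow> f = g) \<and>
        (\<forall>e f g h. crossing_pair E \<gamma> e f \<longrightarrow> crossing_pair E \<gamma> g h \<longrightarrow> {e, f} \<noteq> {g, h} \<longrightarrow>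
           (e \<union> f) \<inter> (g \<union> h) = {}))"

end

theory Submission
  imports Defs
begin

text \<open>
  Crossing pairs occupy pairwise disjoint sets of four vertices, so there are at most \<open>n/4\<close> of
  them. Deleting one edge of each pair leaves a plane bipartite graph, which has at most \<open>2n - 4\<close>
  edges.

  The planar bound is proved without faces, from the Jordan curve theorem and the fact that a
  chord splits the inside of a closed curve. By induction on the number of edges, a plane bipartite
  graph consisting of a cycle of length \<open>c\<close> and of things drawn inside it satisfies
  \<open>2|E| + c + 4 \<le> 4|V|\<close>: a path through the inside joining two vertices of the cycle splits the graph
  into two smaller ones of the same kind, and the two inequalities add up exactly; without such a
  path, every remaining component hangs on at most one vertex of the cycle and can be removed. In a
  general graph, an edge is either a bridge or lies on a cycle; in the second case the parts inside
  and outside the cycle both satisfy the inequality, the latter after an inversion of the plane.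
\<close>

section \<open>Paths and cycles\<close>

text \<open>\<open>gpath E u w P X\<close>: a path from \<open>u\<close> to \<open>w\<close> with at least one edge, recorded by its edge set \<open>P\<close>
  and its vertex set \<open>X\<close>.\<close>

inductive gpath :: "'a set set \<Rightarrow> 'a \<Rightarrow> 'a \<Rightarrow> 'a set set \<Rightarrow> 'a set \<Rightarrow> bool" for E where
  single: "{u, v} \<in> E \<Longrightarrow> u \<noteq> v \<Longrightarrow> gpath E u v {{u, v}} {u, v}"
| step: "gpath E v w P X \<Longrightarrow> {u, v} \<in> E \<Longrightarrow> u \<notin> X \<Longrightarrow>
    gpath E u w (insert {u, v} P) (insert u X)"

lemma gpath_facts:
  assumes "gpath E u w P X"
  shows "finite P" "finite X" "P \<subseteq> E" "u \<in> X" "w \<in> X" "u \<noteq> w" "\<Union>P = X"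
    "card X = Suc (card P)" "P \<noteq> {}"
proof -
  have "finite P \<and> finite X \<and> P \<subseteq> E \<and> u \<in> X \<and> w \<in> X \<and> u \<noteq> w \<and> \<Union>P = X \<and>
    card X = Suc (card P) \<and> P \<noteq> {}"
    using assms
  proof induction
    case (step v w P X u)
    then have "{u, v} \<notin> P"
      by auto
    with step show ?case
      by auto
  qed auto
  then show "finite P" "finite X" "P \<subseteq> E" "u \<in> X" "w \<in> X" "u \<noteq> w" "\<Union>P = X"
    "card X = Suc (card P)" "P \<noteq> {}"
    by auto
qed

lemma gpath_edge_card: "gpath E u w P X \<Longrightarrow> e \<in> P \<Longrightarrow> card e = 2"
proof (induction rule: gpath.induct)
  case (step v w P X u)
  then have "u \<noteq> v"
    using gpath_facts(4)[OF step.hyps(1)] by auto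
  with step show ?case
    by auto
qed auto

lemma gpath_mono: "gpath E u w P X \<Longrightarrow> E \<subseteq> F \<Longrightarrow> gpath F u w P X"
  by (induction rule: gpath.induct) (auto intro: gpath.intros)

text \<open>The induction shows that a path already lives in the graph of its own edges;
  monotonicity does the rest.\<close>

lemma gpath_restrict:
  assumes "gpath E u w P X" "P \<subseteq> F"
  shows "gpath F u w P X"
proof -
  from assms(1) have "gpath P u w P X"
  proof induction
    case (step v w P X u)
    have "gpath (insert {u, v} P) v w P X"
      by (rule gpath_mono[OF step.IH]) auto
    then show ?case
      using step.hyps by (auto intro: gpath.step)
  qed (auto intro: gpath.single)
  then show ?thesis
    using assms(2) by (rule gpath_mono)
qed

lemma gpath_append:
  assumes "gpath E u x P Y" "gpath E x w Q Z" "Y \<inter> Z = {x}"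
  shows "gpath E u w (P \<union> Q) (Y \<union> Z)"
  using assms
proof (induction rule: gpath.induct)
  case (single u v)
  then have "u \<notin> Z" "v \<in> Z"
    by auto
  with single show ?case
    using gpath.step[of E v w Q Z u] by (auto simp: insert_absorb)
next
  case (step v w' P X u)
  then have "w' \<in> X"
    using gpath_facts(5) by metis
  then have "u \<notin> Z" "X \<inter> Z = {w'}"
    using step.prems step.hyps by auto
  then show ?case
    using gpath.step[of E v w "P \<union> Q" "X \<union> Z" u] step by auto
qed

lemma gpath_sym: "gpath E u w P X \<Longrightarrow> gpath E w u P X"
proof (induction rule: gpath.induct)
  case (single u v)
  then show ?case
    using gpath.single[of v u E] by (simp add: insert_commute)
next
  case (step v w P X u)
  then have v: "v \<in> X" "u \<noteq> v"
    using gpath_facts(4)[OF step.hyps(1)] by auto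
  then have "gpath E v u {{u, v}} {u, v}"
    using step gpath.single[of v u E] by (simp add: insert_commute)
  moreover have "X \<inter> {u, v} = {v}"
    using v step by auto
  ultimately have "gpath E w u (P \<union> {{u, v}}) (X \<union> {u, v})"
    by (rule gpath_append[OF step.IH])
  then show ?case
    using v by (simp add: insert_absorb)
qed

text \<open>A shared edge would lie in both vertex sets, hence within one vertex, but path edges
  have two endpoints.\<close>

lemma gpath_disjoint:
  assumes "gpath E u x P Y" "gpath F v y Q Z" "Y \<inter> Z \<subseteq> {x}"
  shows "P \<inter> Q = {}"
proof (rule ccontr)
  assume "P \<inter> Q \<noteq> {}"
  then obtain e where e: "e \<in> P" "e \<in> Q"
    by auto
  then have "e \<subseteq> Y" "e \<subseteq> Z"
    using gpath_facts(7)[OF assms(1)] gpath_facts(7)[OF assms(2)] by auto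
  then have "e \<subseteq> {x}"
    using assms(3) by auto
  then have "card e \<le> 1"
    using card_mono[of "{x}" e] by simp
  then show False
    using gpath_edge_card[OF assms(1) e(1)] by simp
qed

lemma gpath_split:
  assumes "gpath E u w P X" "x \<in> X" "x \<noteq> u" "x \<noteq> w"
  obtains Q Y R Z where "gpath E u x Q Y" "gpath E x w R Z" "Q \<union> R = P" "Y \<union> Z = X"
    "Y \<inter> Z = {x}" "Q \<inter> R = {}"
proof -
  have "\<exists>Q Y R Z. gpath E u x Q Y \<and> gpath E x w R Z \<and> Q \<union> R = P \<and> Y \<union> Z = X \<and> Y \<inter> Z = {x}"
    using assms
  proof (induction rule: gpath.induct)
    case (step v w P X u)
    have v: "v \<in> X" "u \<noteq> v"
      using gpath_facts(4)[OF step.hyps(1)] step.hyps by auto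
    show ?case
    proof (cases "x = v")
      case True
      have "gpath E u v {{u, v}} {u, v}"
        using step v by (auto intro: gpath.single)
      moreover have "{{u, v}} \<union> P = insert {u, v} P" "{u, v} \<union> X = insert u X" "{u, v} \<inter> X = {v}"
        using v step by auto
      ultimately show ?thesis
        using step.hyps True by blast
    next
      case False
      then obtain Q Y R Z where *: "gpath E v x Q Y" "gpath E x w R Z" "Q \<union> R = P" "Y \<union> Z = X"
        "Y \<inter> Z = {x}"
        using step by auto
      then have "gpath E u x (insert {u, v} Q) (insert u Y)"
        using step by (intro gpath.step) auto
      moreover have "insert {u, v} Q \<union> R = insert {u, v} P" "insert u Y \<union> Z = insert u X"
        "insert u Y \<inter> Z = {x}"
        using * step by auto
      ultimately show ?thesis
        using *(2) by blast
    qed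
  qed auto
  then show thesis
    using that gpath_disjoint by (metis subset_refl)
qed

lemma gpath_parity:
  assumes "gpath E u w P X" "\<And>a b. {a, b} \<in> E \<Longrightarrow> col a \<noteq> (col b :: bool)"
  shows "even (card P) \<longleftrightarrow> col u = col w"
  using assms
proof (induction rule: gpath.induct)
  case (step v w P X u)
  then have "{u, v} \<notin> P" "finite P"
    using gpath_facts[OF step.hyps(1)] by auto
  moreover have "col u \<noteq> col v"
    using step by blast
  ultimately show ?case
    using step by auto
qed auto

section \<open>Reachability by simple paths\<close>

definition reachable :: "'a set set \<Rightarrow> 'a \<Rightarrow> 'a set" where
  "reachable E a = {x. x = a \<or> (\<exists>P X. gpath E a x P X)}"

lemma reachable_self: "a \<in> reachable E a"
  by (simp add: reachable_def)

text \<open>Paths are simple, so the edge cannot be appended when \<open>y\<close> already lies on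
  the path; the initial segment up to \<open>y\<close> serves then.\<close>

lemma reachable_step:
  assumes "x \<in> reachable E a" "{x, y} \<in> E" "x \<noteq> y"
  shows "y \<in> reachable E a"
proof (cases "x = a \<or> y = a")
  case True
  then show ?thesis
    using assms gpath.single[of x y E] by (auto simp: reachable_def)
next
  case False
  then obtain P X where P: "gpath E a x P X"
    using assms(1) by (auto simp: reachable_def)
  show ?thesis
  proof (cases "y \<in> X")
    case True
    then obtain Q Y where "gpath E a y Q Y"
      using False assms(3) gpath_split[OF P True] by metis
    then show ?thesis
      by (auto simp: reachable_def)
  next
    case ny: False
    have "X \<inter> {x, y} = {x}"
      using ny gpath_facts(5)[OF P] by auto
    from gpath_append[OF P gpath.single[OF assms(2,3)] this]
    show ?thesis
      by (auto simp: reachable_def)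
  qed
qed

lemma reachable_gpath: "gpath E x y P X \<Longrightarrow> x \<in> reachable E a \<Longrightarrow> y \<in> reachable E a"
proof (induction rule: gpath.induct)
  case (single u v)
  then show ?case
    using reachable_step by metis
next
  case (step v w P X u)
  have "u \<noteq> v"
    using gpath_facts(4)[OF step.hyps(1)] step.hyps by auto
  then show ?case
    using reachable_step step by metis
qed

lemma reachable_connected:
  assumes "x \<in> reachable E a" "y \<in> reachable E a" "x \<noteq> y"
  obtains P X where "gpath E x y P X"
proof -
  have "a \<in> reachable E x"
    using assms(1) gpath_sym unfolding reachable_def by fastforce
  moreover have "y = a \<or> (\<exists>P X. gpath E a y P X)"
    using assms(2) by (simp add: reachable_def)
  ultimately have "y \<in> reachable E x"
    using reachable_gpath by metis
  then show thesis
    using that assms(3) by (auto simp: reachable_def)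
qed

text \<open>If the path meets \<open>W\<close> in a further vertex \<open>x\<close>, its part up to
  \<open>x\<close> again joins two vertices of \<open>W\<close>, and it is shorter because the rest
  has at least one edge.\<close>

lemma shortest_connection:
  assumes "gpath E a b P X" "a \<in> W" "b \<in> W"
  obtains a' b' P' X' where "gpath E a' b' P' X'" "a' \<in> W" "b' \<in> W" "X' \<inter> W = {a', b'}"
  using assms
proof (induction "card P" arbitrary: a b P X thesis rule: less_induct)
  case less
  show ?case
  proof (cases "X \<inter> W = {a, b}")
    case True
    then show ?thesis
      using less by blast
  next
    case False
    then obtain x where x: "x \<in> X" "x \<in> W" "x \<noteq> a" "x \<noteq> b"
      using less.prems gpath_facts(4,5)[OF less.prems(2)] by blast
    obtain Q Y R Z where s: "gpath E a x Q Y" "gpath E x b R Z" "Q \<union> R = P" "Q \<inter> R = {}"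
      using gpath_split[OF less.prems(2) x(1,3,4)] by metis
    have "card P = card Q + card R" "card R > 0"
      using s gpath_facts(1,9)[OF s(1)] gpath_facts(1,9)[OF s(2)]
      by (auto simp: card_Un_disjoint card_gt_0_iff)
    then show ?thesis
      using less.hyps[of Q thesis a x Y] less.prems s x by force
  qed
qed

section \<open>Cycles as pairs of paths with common ends\<close>

definition cycle_between ::
  "'a set set \<Rightarrow> 'a \<Rightarrow> 'a \<Rightarrow> 'a set set \<Rightarrow> 'a set \<Rightarrow> 'a set set \<Rightarrow> 'a set \<Rightarrow> bool" where
  "cycle_between E u v P X Q Y \<longleftrightarrow>
     gpath E u v P X \<and> gpath E u v Q Y \<and> X \<inter> Y = {u, v} \<and> P \<inter> Q = {}"

text \<open>The two-path form fits the splitting of a closed curve by a chord. Disjointness of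
  \<open>P\<close> and \<open>Q\<close> rules out a single edge traversed twice.\<close>

definition is_cycle :: "'a set set \<Rightarrow> 'a set set \<Rightarrow> 'a set \<Rightarrow> bool" where
  "is_cycle E C W \<longleftrightarrow>
     (\<exists>u v P X Q Y. cycle_between E u v P X Q Y \<and> C = P \<union> Q \<and> W = X \<union> Y)"

lemma cycle_between_swap: "cycle_between E u v P X Q Y \<Longrightarrow> cycle_between E u v Q Y P X"
  by (auto simp: cycle_between_def)

lemma cycle_between_sym: "cycle_between E u v P X Q Y \<Longrightarrow> cycle_between E v u P X Q Y"
  by (auto simp: cycle_between_def intro: gpath_sym)

text \<open>The segment of \<open>P\<close> between \<open>u\<close> and \<open>x\<close> is handed
  over to the other path, so that \<open>x\<close> replaces \<open>u\<close> as a common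
  end.\<close>

lemma cycle_between_move_path:
  assumes "cycle_between E u v P X Q Y" "x \<in> X" "x \<noteq> v"
  obtains P' X' Q' Y' where "cycle_between E x v P' X' Q' Y'" "P' \<union> Q' = P \<union> Q" "X' \<union> Y' = X \<union> Y"
proof (cases "x = u")
  case True
  then show thesis
    using that assms by blast
next
  case False
  have c: "gpath E u v P X" "gpath E u v Q Y" "X \<inter> Y = {u, v}" "P \<inter> Q = {}"
    using assms(1) by (auto simp: cycle_between_def)
  obtain P1 X1 P2 X2 where s: "gpath E u x P1 X1" "gpath E x v P2 X2" "P1 \<union> P2 = P" "X1 \<union> X2 = X"
    "X1 \<inter> X2 = {x}" "P1 \<inter> P2 = {}"
    using gpath_split[OF c(1) assms(2) False assms(3)] by metis
  have ends: "u \<in> X1" "v \<in> X2" "u \<in> Y" "v \<in> Y" "x \<in> X1" "x \<in> X2"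
    using gpath_facts(4,5) s c by metis+
  have uv: "u \<noteq> v"
    using gpath_facts(6)[OF c(1)] .
  have u2: "u \<notin> X2" "v \<notin> X1"
    using ends s False assms(3) by auto
  have "X1 \<inter> Y = {u}"
    using u2 c(3) ends s(4) by auto
  then have "gpath E x v (P1 \<union> Q) (X1 \<union> Y)"
    by (rule gpath_append[OF gpath_sym[OF s(1)] c(2)])
  moreover have "X2 \<inter> (X1 \<union> Y) = {x, v}"
    using u2 c(3) ends s(4,5) by auto
  moreover have "P2 \<inter> (P1 \<union> Q) = {}"
    using s c by auto
  ultimately have "cycle_between E x v P2 X2 (P1 \<union> Q) (X1 \<union> Y)"
    using s by (auto simp: cycle_between_def)
  then show thesis
    using that s by blast
qed

lemma cycle_between_move:
  assumes "cycle_between E u v P X Q Y" "x \<in> X \<union> Y" "x \<noteq> v"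
  obtains P' X' Q' Y' where "cycle_between E x v P' X' Q' Y'" "P' \<union> Q' = P \<union> Q" "X' \<union> Y' = X \<union> Y"
proof (cases "x \<in> X")
  case True
  then show thesis
    using cycle_between_move_path assms that by metis
next
  case False
  then show thesis
    using cycle_between_move_path[OF cycle_between_swap[OF assms(1)], of x] assms(2,3) that
    by (metis UnE Un_commute)
qed

lemma is_cycle_between:
  assumes "is_cycle E C W" "a \<in> W" "b \<in> W" "a \<noteq> b"
  obtains P X Q Y where "cycle_between E a b P X Q Y" "P \<union> Q = C" "X \<union> Y = W"
proof -
  obtain u v P X Q Y where c: "cycle_between E u v P X Q Y" "C = P \<union> Q" "W = X \<union> Y"
    using assms(1) unfolding is_cycle_def by blast
  \<comment> \<open>First one common end becomes \<open>a\<close>; afterwards the other one can be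
    moved to \<open>b\<close>.\<close>
  have "\<exists>v P X Q Y. v \<noteq> a \<and> cycle_between E v a P X Q Y \<and> C = P \<union> Q \<and> W = X \<union> Y"
  proof (cases "a = v")
    case True
    then show ?thesis
      using c gpath_facts(6) unfolding cycle_between_def by metis
  next
    case False
    then show ?thesis
      using cycle_between_move[OF c(1), of a] c assms(2) cycle_between_sym by metis
  qed
  then show thesis
    using cycle_between_move cycle_between_sym assms(3,4) that by metis
qed

lemma is_cycle_facts:
  assumes "is_cycle E C W"
  shows "C \<subseteq> E" "C \<noteq> {}" "\<Union>C = W" "finite C" "finite W" "card W = card C"
proof -
  obtain u v P X Q Y where c: "gpath E u v P X" "gpath E u v Q Y" "X \<inter> Y = {u, v}" "P \<inter> Q = {}"
    "C = P \<union> Q" "W = X \<union> Y"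
    using assms unfolding is_cycle_def cycle_between_def by blast
  note f = gpath_facts[OF c(1)] gpath_facts[OF c(2)]
  show "C \<subseteq> E" "C \<noteq> {}" "\<Union>C = W" "finite C" "finite W"
    using f c by auto
  have "card X + card Y = card W + card {u, v}"
    using card_Un_Int f c by metis
  moreover have "card C = card P + card Q"
    using card_Un_disjoint f c by metis
  ultimately show "card W = card C"
    using f by simp
qed

text \<open>The colouring gives both paths lengths of equal parity, and they cannot both be the
  single edge \<open>{u, v}\<close>.\<close>

lemma bipartite_cycle_length:
  assumes "is_cycle E C W" "\<And>a b. {a, b} \<in> E \<Longrightarrow> col a \<noteq> (col b :: bool)"
  shows "4 \<le> card C"
proof -
  obtain u v P X Q Y where c: "gpath E u v P X" "gpath E u v Q Y" "X \<inter> Y = {u, v}" "P \<inter> Q = {}"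
    "C = P \<union> Q" "W = X \<union> Y"
    using assms(1) unfolding is_cycle_def cycle_between_def by blast
  note f = gpath_facts[OF c(1)] gpath_facts[OF c(2)]
  have card_C: "card C = card P + card Q"
    using card_Un_disjoint f c by metis
  have single: "R = {{u, v}}" if "gpath E u v R Z" "card R = 1" for R Z
  proof -
    have "Z = {u, v}"
      using gpath_facts[OF that(1)] that(2) card_subset_eq[of Z "{u, v}"] by simp
    then show ?thesis
      using gpath_facts(7)[OF that(1)] that(2) by (auto simp: card_1_singleton_iff)
  qed
  have "even (card P) = even (card Q)"
    using gpath_parity[OF c(1), of col] gpath_parity[OF c(2), of col] assms(2) by simp
  moreover have "card P > 0" "card Q > 0"
    using f by (auto simp: card_gt_0_iff)
  moreover have "\<not> (card P = 1 \<and> card Q = 1)"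
  proof
    assume "card P = 1 \<and> card Q = 1"
    then have "P = Q"
      using single[OF c(1)] single[OF c(2)] by simp
    then show False
      using c(4) f(9) by simp
  qed
  ultimately show ?thesis
    unfolding card_C by presburger
qed


section \<open>Plane bipartite graphs\<close>

text \<open>An edge is recorded by its point set \<open>A e\<close>, not by a parametrization, so
  orientation disappears and a map of the plane acts by images.\<close>

locale plane_bipartite =
  fixes V :: "'a set" and E :: "'a set set" and pos :: "'a \<Rightarrow> complex"
    and A :: "'a set \<Rightarrow> complex set" and col :: "'a \<Rightarrow> bool"
  assumes finite_V: "finite V"
    and edge: "e \<in> E \<Longrightarrow> \<exists>u\<in>V. \<exists>v\<in>V. e = {u, v} \<and> col u \<noteq> col v"
    and inj_pos: "inj_on pos V"
    and drawn_as_arc: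
      "e \<in> E \<Longrightarrow> \<exists>g. arc g \<and> path_image g = A e \<and> {pathstart g, pathfinish g} = pos ` e"
    and vertex_on_edge: "e \<in> E \<Longrightarrow> v \<in> V \<Longrightarrow> pos v \<in> A e \<Longrightarrow> v \<in> e"
    and no_crossing: "e \<in> E \<Longrightarrow> f \<in> E \<Longrightarrow> e \<noteq> f \<Longrightarrow> A e \<inter> A f \<subseteq> pos ` (e \<inter> f)"
begin

lemma subgraph:
  assumes "V' \<subseteq> V" "E' \<subseteq> E" "\<And>e. e \<in> E' \<Longrightarrow> e \<subseteq> V'"
  shows "plane_bipartite V' E' pos A col"
proof
  show "finite V'"
    using finite_subset[OF assms(1) finite_V] .
  show "inj_on pos V'"
    using inj_on_subset[OF inj_pos assms(1)] .
  show "\<exists>u\<in>V'. \<exists>v\<in>V'. e = {u, v} \<and> col u \<noteq> col v" if "e \<in> E'" for e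
    using edge[of e] assms(2) assms(3)[OF that] that by blast
  show "\<exists>g. arc g \<and> path_image g = A e \<and> {pathstart g, pathfinish g} = pos ` e" if "e \<in> E'" for e
    using drawn_as_arc assms(2) that by blast
  show "v \<in> e" if "e \<in> E'" "v \<in> V'" "pos v \<in> A e" for e v
    using vertex_on_edge assms(1,2) that by blast
  show "A e \<inter> A f \<subseteq> pos ` (e \<inter> f)" if "e \<in> E'" "f \<in> E'" "e \<noteq> f" for e f
    using no_crossing assms(2) that by blast
qed

text \<open>The map need only behave well on a set \<open>S\<close> containing the drawing, as an
  inversion does away from its centre.\<close>

lemma homeomorphic_image:
  assumes "continuous_on S f" "inj_on f S" "pos ` V \<subseteq> S" "\<And>e. e \<in> E \<Longrightarrow> A e \<subseteq> S"
  shows "plane_bipartite V E (f \<circ> pos) (\<lambda>e. f ` A e) col"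
proof
  show "finite V"
    by (rule finite_V)
  show "inj_on (f \<circ> pos) V"
    using inj_pos assms by (auto intro!: comp_inj_on inj_on_subset[of f S])
  show "\<exists>u\<in>V. \<exists>v\<in>V. e = {u, v} \<and> col u \<noteq> col v" if "e \<in> E" for e
    using edge that .
  show "\<exists>g. arc g \<and> path_image g = f ` A e \<and> {pathstart g, pathfinish g} = (f \<circ> pos) ` e"
    if e: "e \<in> E" for e
  proof -
    obtain g where g: "arc g" "path_image g = A e" "{pathstart g, pathfinish g} = pos ` e"
      using drawn_as_arc[OF e] by blast
    have "path_image g \<subseteq> S"
      using assms(4)[OF e] g by simp
    then have "arc (f \<circ> g)"
      using g(1) continuous_on_subset[OF assms(1)] inj_on_subset[OF assms(2)]
      by (auto simp: arc_def path_image_def intro!: path_continuous_image comp_inj_on)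
    moreover have "{pathstart (f \<circ> g), pathfinish (f \<circ> g)} = (f \<circ> pos) ` e"
      using g(3) by (metis image_comp image_empty image_insert pathfinish_compose pathstart_compose)
    ultimately show ?thesis
      using g by (metis path_image_compose)
  qed
  show "v \<in> e" if "e \<in> E" "v \<in> V" "(f \<circ> pos) v \<in> f ` A e" for e v
  proof -
    have "pos v \<in> A e"
      using that assms by (auto dest!: inj_onD[OF assms(2)])
    then show ?thesis
      using vertex_on_edge that by blast
  qed
  show "f ` A e \<inter> f ` A e' \<subseteq> (f \<circ> pos) ` (e \<inter> e')" if "e \<in> E" "e' \<in> E" "e \<noteq> e'" for e e'
  proof -
    have "f ` A e \<inter> f ` A e' = f ` (A e \<inter> A e')"
      using inj_on_image_Int[OF assms(2)] assms(4) that by metis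
    then show ?thesis
      using no_crossing[OF that] by (auto simp: image_comp[symmetric])
  qed
qed

lemma finite_E: "finite E"
proof -
  have "E \<subseteq> Pow V"
    using edge by blast
  then show ?thesis
    using finite_V finite_subset by auto
qed

lemma edge_subset: "e \<in> E \<Longrightarrow> e \<subseteq> V"
  using edge by blast

lemma col_differs: "{a, b} \<in> E \<Longrightarrow> col a \<noteq> col b"
  using edge by (metis doubleton_eq_iff)

lemma endpoint_in_edge: "e \<in> E \<Longrightarrow> v \<in> e \<Longrightarrow> pos v \<in> A e"
  using drawn_as_arc[of e] by (metis image_eqI insertE pathfinish_in_path_image pathstart_in_path_image singletonD)

lemma edge_arc_between:
  assumes "{u, v} \<in> E"
  obtains g where "arc g" "path_image g = A {u, v}" "pathstart g = pos u" "pathfinish g = pos v"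
proof -
  obtain g where g: "arc g" "path_image g = A {u, v}" "{pathstart g, pathfinish g} = {pos u, pos v}"
    using drawn_as_arc[OF assms] by auto
  then consider "pathstart g = pos u" "pathfinish g = pos v" | "pathstart g = pos v" "pathfinish g = pos u"
    by (auto simp: doubleton_eq_iff)
  then show thesis
  proof cases
    case 1
    then show ?thesis
      using that g by blast
  next
    case 2
    then show ?thesis
      using that[of "reversepath g"] g by (auto intro: arc_reversepath)
  qed
qed

text \<open>The open edge, that is the arc without its ends, is the image of the open unit interval;
  by continuity its closure contains the whole arc.\<close>

lemma edge_inner:
  assumes "e \<in> E"
  shows "connected (A e - pos ` e)" "A e - pos ` e \<noteq> {}" "A e \<subseteq> closure (A e - pos ` e)"
    "compact (A e)"
proof -
  obtain g where g: "arc g" "path_image g = A e" "{pathstart g, pathfinish g} = pos ` e"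
    using drawn_as_arc[OF assms] by blast
  then have sp: "simple_path g"
    by (simp add: arc_imp_simple_path)
  show "connected (A e - pos ` e)" "A e - pos ` e \<noteq> {}"
    using connected_simple_path_endless[OF sp] nonempty_simple_path_endless[OF sp] g by auto
  show "compact (A e)"
    using compact_path_image[OF simple_path_imp_path[OF sp]] g by simp
  have eq: "A e - pos ` e = g ` {0<..<1}"
    using simple_path_endless[OF sp] g by simp
  have "g ` closure {0<..<1} \<subseteq> closure (g ` {0<..<1})"
    using sp by (intro image_closure_subset) (auto simp: simple_path_def path_def closure_subset)
  then show "A e \<subseteq> closure (A e - pos ` e)"
    using g(2) unfolding eq by (simp add: path_image_def)
qed

text \<open>Connectedness of the open edge; this is what assigns each edge to one side of a
  cycle.\<close>

lemma edge_inner_side: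
  assumes "e \<in> E" "A e - pos ` e \<subseteq> S \<union> T" "open S" "open T" "S \<inter> T = {}"
  shows "A e - pos ` e \<subseteq> S \<or> A e - pos ` e \<subseteq> T"
  using connectedD[OF edge_inner(1)[OF assms(1)] assms(3,4)] assms(2,5) by blast

lemma compact_image: "P \<subseteq> E \<Longrightarrow> compact (\<Union>(A ` P))"
  using edge_inner(4) finite_E finite_subset by (auto intro!: compact_UN)

lemma images_inter:
  assumes "P \<subseteq> E" "Q \<subseteq> E" "P \<inter> Q = {}"
  shows "\<Union>(A ` P) \<inter> \<Union>(A ` Q) \<subseteq> pos ` (\<Union>P \<inter> \<Union>Q)"
proof
  fix z
  assume "z \<in> \<Union>(A ` P) \<inter> \<Union>(A ` Q)"
  then obtain e f where ef: "e \<in> P" "f \<in> Q" "z \<in> A e \<inter> A f"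
    by auto
  then have "e \<in> E" "f \<in> E" "e \<noteq> f"
    using assms by auto
  then have "z \<in> pos ` (e \<inter> f)"
    using no_crossing ef by blast
  then show "z \<in> pos ` (\<Union>P \<inter> \<Union>Q)"
    using ef by auto
qed

lemma vertex_on_image: "P \<subseteq> E \<Longrightarrow> v \<in> V \<Longrightarrow> pos v \<in> \<Union>(A ` P) \<Longrightarrow> v \<in> \<Union>P"
  using vertex_on_edge by blast

lemma edge_inner_avoids_image:
  assumes "e \<in> E" "P \<subseteq> E" "e \<notin> P"
  shows "(A e - pos ` e) \<inter> \<Union>(A ` P) = {}"
  using images_inter[of "{e}" P] assms by auto

section \<open>Arcs and closed curves drawn by paths and cycles\<close>

lemma gpath_arc:
  assumes "gpath E u w P X"
  obtains g where "arc g" "path_image g = \<Union>(A ` P)" "pathstart g = pos u" "pathfinish g = pos w"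
proof -
  have "\<exists>g. arc g \<and> path_image g = \<Union>(A ` P) \<and> pathstart g = pos u \<and> pathfinish g = pos w"
    using assms
  proof induction
    case (single u v)
    then obtain g where "arc g" "path_image g = A {u, v}" "pathstart g = pos u" "pathfinish g = pos v"
      using edge_arc_between by blast
    then show ?case
      by auto
  next
    case (step v w P X u)
    note f = gpath_facts[OF step.hyps(1)]
    obtain g where g: "arc g" "path_image g = \<Union>(A ` P)" "pathstart g = pos v" "pathfinish g = pos w"
      using step.IH by blast
    obtain h where h: "arc h" "path_image h = A {u, v}" "pathstart h = pos u" "pathfinish h = pos v"
      using edge_arc_between[OF step.hyps(2)] by blast
    have "{u, v} \<notin> P"
      using f step.hyps by auto
    then have "A {u, v} \<inter> \<Union>(A ` P) \<subseteq> pos ` ({u, v} \<inter> X)"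
      using images_inter[of "{{u, v}}" P] f step.hyps by auto
    \<comment> \<open>As \<open>u\<close> is not in \<open>X\<close>, the new arc meets the old one
      in \<open>v\<close> only.\<close>
    then have "path_image h \<inter> path_image g \<subseteq> {pathstart g}"
      using g h step.hyps by auto
    then have "arc (h +++ g)"
      using g h by (intro arc_join) auto
    moreover have "path_image (h +++ g) = \<Union>(A ` insert {u, v} P)"
      using g h by (simp add: path_image_join)
    ultimately show ?case
      using g h by (metis pathfinish_join pathstart_join)
  qed
  then show thesis
    using that by blast
qed

lemma paths_meet_in_ends:
  assumes "gpath E a b P X" "gpath E a b Q Y" "X \<inter> Y = {a, b}" "P \<inter> Q = {}"
  shows "\<Union>(A ` P) \<inter> \<Union>(A ` Q) = {pos a, pos b}"
proof -
  have "{pos a, pos b} \<subseteq> \<Union>(A ` R)" if R: "gpath E a b R Z" for R Z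
    using gpath_facts(3,4,5,7)[OF R] endpoint_in_edge by blast
  then have "{pos a, pos b} \<subseteq> \<Union>(A ` P) \<inter> \<Union>(A ` Q)"
    using assms(1,2) by blast
  moreover have "\<Union>(A ` P) \<inter> \<Union>(A ` Q) \<subseteq> {pos a, pos b}"
    using images_inter[of P Q] gpath_facts(3,7)[OF assms(1)] gpath_facts(3,7)[OF assms(2)] assms(3,4)
    by auto
  ultimately show ?thesis
    by blast
qed

lemma pos_ends_neq:
  assumes "gpath E a b P X"
  shows "pos a \<noteq> pos b"
proof -
  have "a \<in> V" "b \<in> V" "a \<noteq> b"
    using gpath_facts(3,4,5,6,7)[OF assms] edge_subset by blast+
  then show ?thesis
    using inj_pos by (auto dest: inj_onD)
qed

lemma cycle_inside_nonempty:
  assumes "is_cycle E C W"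
  shows "inside (\<Union>(A ` C)) \<noteq> {}"
proof -
  obtain u v P X Q Y where c: "gpath E u v P X" "gpath E u v Q Y" "X \<inter> Y = {u, v}" "P \<inter> Q = {}"
    "C = P \<union> Q"
    using assms unfolding is_cycle_def cycle_between_def by blast
  obtain g where g: "arc g" "path_image g = \<Union>(A ` P)" "pathstart g = pos u" "pathfinish g = pos v"
    using gpath_arc[OF c(1)] .
  obtain h where h: "arc h" "path_image h = \<Union>(A ` Q)" "pathstart h = pos v" "pathfinish h = pos u"
    using gpath_arc[OF gpath_sym[OF c(2)]] .
  have "simple_path (g +++ h)"
    using g h paths_meet_in_ends[OF c(1-4)] by (intro simple_path_join_loop) auto
  moreover have "pathfinish (g +++ h) = pathstart (g +++ h)"
    using g h by simp
  ultimately have "inside (path_image (g +++ h)) \<noteq> {}"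
    using Jordan_inside_outside by blast
  moreover have "path_image (g +++ h) = \<Union>(A ` C)"
    using g h c by (simp add: path_image_join)
  ultimately show ?thesis
    by simp
qed

text \<open>The three drawn paths form a theta curve: arcs with common ends that meet pairwise only
  there. The chord has a point inside the cycle, so the library theorem on splitting the inside of a
  simple closed curve applies.\<close>

lemma chord_splits_inside:
  assumes c: "cycle_between E a b P X Q Y"
    and R: "gpath E a b R Z" "Z \<inter> (X \<union> Y) = {a, b}" "R \<inter> (P \<union> Q) = {}"
    and "\<Union>(A ` R) \<inter> inside (\<Union>(A ` (P \<union> Q))) \<noteq> {}"
  shows "inside (\<Union>(A ` (P \<union> R))) \<inter> inside (\<Union>(A ` (Q \<union> R))) = {}"
    and "inside (\<Union>(A ` (P \<union> R))) \<union> inside (\<Union>(A ` (Q \<union> R))) \<union> (\<Union>(A ` R) - {pos a, pos b}) =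
      inside (\<Union>(A ` (P \<union> Q)))"
proof -
  have PQ: "gpath E a b P X" "gpath E a b Q Y" "X \<inter> Y = {a, b}" "P \<inter> Q = {}"
    using c by (auto simp: cycle_between_def)
  obtain g where g: "arc g" "path_image g = \<Union>(A ` P)" "pathstart g = pos a" "pathfinish g = pos b"
    using gpath_arc[OF PQ(1)] .
  obtain h where h: "arc h" "path_image h = \<Union>(A ` Q)" "pathstart h = pos a" "pathfinish h = pos b"
    using gpath_arc[OF PQ(2)] .
  obtain k where k: "arc k" "path_image k = \<Union>(A ` R)" "pathstart k = pos a" "pathfinish k = pos b"
    using gpath_arc[OF R(1)] .
  have XZ: "X \<inter> Z = {a, b}" "Y \<inter> Z = {a, b}" "P \<inter> R = {}" "Q \<inter> R = {}"
    using R gpath_facts(4,5)[OF PQ(1)] gpath_facts(4,5)[OF PQ(2)] by auto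
  have ne: "path_image k \<inter> inside (path_image g \<union> path_image h) \<noteq> {}"
    using assms(5) g h k by simp
  note split = split_inside_simple_closed_curve[OF arc_imp_simple_path[OF g(1)] g(3,4)
      arc_imp_simple_path[OF h(1)] h(3,4) arc_imp_simple_path[OF k(1)] k(3,4) pos_ends_neq[OF PQ(1)]
      _ _ _ ne]
  have *: "path_image g \<inter> path_image h = {pos a, pos b}" "path_image g \<inter> path_image k = {pos a, pos b}"
    "path_image h \<inter> path_image k = {pos a, pos b}"
    using paths_meet_in_ends PQ R XZ g h k by metis+
  show "inside (\<Union>(A ` (P \<union> R))) \<inter> inside (\<Union>(A ` (Q \<union> R))) = {}"
    unfolding image_Un Union_Un_distrib g(2)[symmetric] h(2)[symmetric] k(2)[symmetric]
    by (rule split[OF *])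
  show "inside (\<Union>(A ` (P \<union> R))) \<union> inside (\<Union>(A ` (Q \<union> R))) \<union> (\<Union>(A ` R) - {pos a, pos b}) =
      inside (\<Union>(A ` (P \<union> Q)))"
    unfolding image_Un Union_Un_distrib g(2)[symmetric] h(2)[symmetric] k(2)[symmetric]
    by (rule split[OF *])
qed

end

section \<open>Parts of a drawing bounded by a cycle\<close>

definition region_verts :: "'a set \<Rightarrow> ('a \<Rightarrow> complex) \<Rightarrow> 'a set set \<Rightarrow> complex set \<Rightarrow> 'a set" where
  "region_verts V pos C D = \<Union>C \<union> {v \<in> V. pos v \<in> D}"

text \<open>\<open>D\<close> will be the inside or the outside of the drawn cycle \<open>C\<close>.
  Membership is tested on open edges because an edge of the region may end on the cycle.\<close>

definition region_edges ::
  "'a set set \<Rightarrow> ('a \<Rightarrow> complex) \<Rightarrow> ('a set \<Rightarrow> complex set) \<Rightarrow> 'a set set \<Rightarrow> complex set \<Rightarrow> 'a set set" where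
  "region_edges E pos A C D = C \<union> {e \<in> E. A e - pos ` e \<subseteq> D}"

context plane_bipartite
begin

text \<open>An edge whose open part lies in \<open>D\<close> has its ends in the closure of
  \<open>D\<close>, hence in \<open>D\<close> or on the drawing of \<open>C\<close>; a vertex placed
  on that drawing belongs to \<open>C\<close>.\<close>

lemma region_subgraph:
  assumes "C \<subseteq> E" "frontier D \<subseteq> \<Union>(A ` C)"
  shows "plane_bipartite (region_verts V pos C D) (region_edges E pos A C D) pos A col"
proof (rule subgraph)
  show "region_verts V pos C D \<subseteq> V" "region_edges E pos A C D \<subseteq> E"
    using assms edge_subset by (auto simp: region_verts_def region_edges_def)
  fix e
  assume e: "e \<in> region_edges E pos A C D"
  show "e \<subseteq> region_verts V pos C D"
  proof (cases "e \<in> C")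
    case True
    then show ?thesis
      by (auto simp: region_verts_def)
  next
    case False
    then have e: "e \<in> E" "A e - pos ` e \<subseteq> D"
      using e by (auto simp: region_edges_def)
    have "A e \<subseteq> closure D"
      using edge_inner(3)[OF e(1)] closure_mono[OF e(2)] by blast
    also have "closure D \<subseteq> D \<union> \<Union>(A ` C)"
      using assms(2) by (auto simp: closure_Un_frontier)
    finally have "A e \<subseteq> D \<union> \<Union>(A ` C)" .
    then show ?thesis
      using e(1) endpoint_in_edge edge_subset vertex_on_image[OF assms(1)]
      unfolding region_verts_def by blast
  qed
qed

end

text \<open>Stands in for a plane graph whose outer face is bounded by the cycle \<open>C\<close>,
  without any notion of face.\<close>

definition plane_disc ::
  "'a set \<Rightarrow> 'a set set \<Rightarrow> ('a \<Rightarrow> complex) \<Rightarrow> ('a set \<Rightarrow> complex set) \<Rightarrow> ('a \<Rightarrow> bool) \<Rightarrow>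
    'a set set \<Rightarrow> 'a set \<Rightarrow> bool" where
  "plane_disc V E pos A col C W \<longleftrightarrow>
     plane_bipartite V E pos A col \<and> is_cycle E C W \<and>
     (\<forall>v\<in>V - W. pos v \<in> inside (\<Union>(A ` C))) \<and>
     (\<forall>e\<in>E - C. A e - pos ` e \<subseteq> inside (\<Union>(A ` C)))"

lemma is_cycle_restrict: "is_cycle E C W \<Longrightarrow> C \<subseteq> F \<Longrightarrow> is_cycle F C W"
  unfolding is_cycle_def cycle_between_def by (metis gpath_restrict le_sup_iff)

lemma (in plane_bipartite) region_disc:
  assumes "is_cycle E C W"
  defines "D \<equiv> inside (\<Union>(A ` C))"
  shows "plane_disc (region_verts V pos C D) (region_edges E pos A C D) pos A col C W"
proof -
  have C: "C \<subseteq> E" "\<Union>C = W"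
    using is_cycle_facts[OF assms(1)] by auto
  have "frontier D \<subseteq> \<Union>(A ` C)"
    unfolding D_def using compact_image[OF C(1)] by (simp add: compact_imp_closed frontier_inside_subset)
  then have "plane_bipartite (region_verts V pos C D) (region_edges E pos A C D) pos A col"
    using region_subgraph C by blast
  moreover have "is_cycle (region_edges E pos A C D) C W"
    by (rule is_cycle_restrict[OF assms(1)]) (auto simp: region_edges_def)
  ultimately show ?thesis
    using C by (auto simp: plane_disc_def region_verts_def region_edges_def D_def)
qed

section \<open>Inversion\<close>

text \<open>If \<open>f z\<close> were outside the image of \<open>S\<close>, that outside without
  \<open>0\<close>, the image of infinity, would pull back to a connected set avoiding
  \<open>S\<close>. It contains \<open>z\<close>, outside \<open>S\<close>, and, since the outside
  of the image is unbounded, also a point close to \<open>p\<close>, inside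
  \<open>S\<close>.\<close>

lemma inversion_outside_to_inside:
  fixes p z :: complex
  defines "f \<equiv> \<lambda>z. inverse (z - p)"
  assumes "compact S" "p \<in> inside S" "z \<in> outside S"
  shows "f z \<in> inside (f ` S)"
proof (rule ccontr)
  assume neg: "f z \<notin> inside (f ` S)"
  have p: "p \<notin> S" "z \<noteq> p" "z \<notin> S"
    using assms inside_no_overlap[of S] outside_no_overlap[of S] inside_Int_outside[of S] by blast+
  have "continuous_on S f"
    unfolding f_def using p by (intro continuous_intros) auto
  then have cS: "compact (f ` S)"
    using assms(2) by (rule compact_continuous_image)
  have "f z \<notin> f ` S"
    using p by (auto simp: f_def)
  then have fz: "f z \<in> outside (f ` S)"
    using neg inside_Un_outside[of "f ` S"] by blast
  have fz0: "f z \<noteq> 0"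
    using p by (simp add: f_def)
  have "open (inside S)" "open (outside S)" "open (outside (f ` S))"
    using assms(2) cS by (auto intro: open_inside open_outside compact_imp_closed)
  then obtain \<epsilon> where \<epsilon>: "\<epsilon> > 0" "ball p \<epsilon> \<subseteq> inside S"
    using assms(3) openE by blast
  have "\<not> bounded (outside (f ` S))"
    using cS by (simp add: compact_imp_bounded unbounded_outside)
  \<comment> \<open>A far point \<open>w\<close> comes from \<open>p + inverse w\<close>; the bound
    \<open>1 / \<epsilon>\<close> puts that point into the ball around \<open>p\<close>.\<close>
  then obtain w where w: "w \<in> outside (f ` S)" "norm w > 1 / \<epsilon>"
    unfolding bounded_iff by (meson not_le)
  have w0: "w \<noteq> 0"
    using w \<epsilon> by auto
  have "norm (inverse w) < \<epsilon>"
    using w \<epsilon> w0 unfolding norm_inverse by (simp add: field_simps)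
  then have w_in: "p + inverse w \<in> inside S"
    using \<epsilon> by (auto simp: dist_norm)
  define T where "T = (\<lambda>w. p + inverse w) ` (outside (f ` S) - {0})"
  have "connected (outside (f ` S) - {0})"
    using cS \<open>open (outside (f ` S))\<close>
    by (intro connected_open_delete connected_outside) (auto simp: compact_imp_bounded)
  then have "connected T"
    unfolding T_def by (intro connected_continuous_image continuous_intros) auto
  moreover have "T \<subseteq> inside S \<union> outside S"
  proof -
    have "p + inverse y \<notin> S" if "y \<in> outside (f ` S)" "y \<noteq> 0" for y
    proof
      assume "p + inverse y \<in> S"
      then have "f (p + inverse y) \<in> f ` S"
        by blast
      then have "y \<in> f ` S"
        by (simp add: f_def)
      then show False
        using that outside_no_overlap by blast
    qed
    then show ?thesis
      by (auto simp: T_def)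
  qed
  moreover have "p + inverse w \<in> T"
    using w w0 by (auto simp: T_def)
  moreover have "z \<in> T"
  proof -
    have "z = p + inverse (f z)"
      by (simp add: f_def)
    then show ?thesis
      using fz fz0 unfolding T_def by blast
  qed
  ultimately show False
    using connectedD[of T "inside S" "outside S"] \<open>open (inside S)\<close> \<open>open (outside S)\<close> w_in assms(4)
      inside_Int_outside[of S] by blast
qed

text \<open>The inversion is centred at a point \<open>p\<close> inside the cycle. The drawing of
  the outer region avoids \<open>p\<close>, so positions and arcs are moved injectively while the
  graph and its cycle stay the same.\<close>

lemma (in plane_bipartite) region_outside_disc:
  assumes "is_cycle E C W"
  defines "D \<equiv> outside (\<Union>(A ` C))"
  obtains pos' A' where
    "plane_disc (region_verts V pos C D) (region_edges E pos A C D) pos' A' col C W"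
proof -
  have C: "C \<subseteq> E" "\<Union>C = W"
    using is_cycle_facts[OF assms(1)] by auto
  have comp: "compact (\<Union>(A ` C))"
    using compact_image[OF C(1)] .
  then have "frontier D \<subseteq> \<Union>(A ` C)"
    unfolding D_def by (simp add: compact_imp_closed frontier_outside_subset)
  then have sub: "plane_bipartite (region_verts V pos C D) (region_edges E pos A C D) pos A col"
    using region_subgraph C by blast
  obtain p where p: "p \<in> inside (\<Union>(A ` C))"
    using cycle_inside_nonempty[OF assms(1)] by blast
  define f where "f = (\<lambda>z. inverse (z - p))"
  have pD: "p \<notin> D" "p \<notin> \<Union>(A ` C)"
    unfolding D_def using p inside_Int_outside[of "\<Union>(A ` C)"] inside_no_overlap[of "\<Union>(A ` C)"]
    by blast+
  have inj: "inj_on f (- {p})"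
    by (auto simp: inj_on_def f_def)
  have cont: "continuous_on (- {p}) f"
    unfolding f_def by (intro continuous_intros) auto
  have posC: "pos v \<in> \<Union>(A ` C)" if "v \<in> \<Union>C" for v
    using that C(1) endpoint_in_edge by blast
  have V: "pos ` region_verts V pos C D \<subseteq> - {p}"
  proof -
    have "pos v \<noteq> p" if "v \<in> region_verts V pos C D" for v
      using that posC[of v] pD unfolding region_verts_def by blast
    then show ?thesis
      by blast
  qed
  have E: "A e \<subseteq> - {p}" if e: "e \<in> region_edges E pos A C D" for e
  proof -
    have "pos ` e \<subseteq> - {p}"
      using V plane_bipartite.edge_subset[OF sub e] by blast
    then show ?thesis
      using e pD unfolding region_edges_def by blast
  qed
  have "plane_bipartite (region_verts V pos C D) (region_edges E pos A C D) (f \<circ> pos) (\<lambda>e. f ` A e) col"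
    using plane_bipartite.homeomorphic_image[OF sub cont inj V E] by blast
  moreover have "is_cycle (region_edges E pos A C D) C W"
    by (rule is_cycle_restrict[OF assms(1)]) (auto simp: region_edges_def)
  moreover have D_in: "f z \<in> inside (\<Union>((\<lambda>e. f ` A e) ` C))" if "z \<in> D" for z
    using inversion_outside_to_inside[OF comp p, of z] that
    by (simp add: D_def f_def image_UN)
  moreover have "f ` A e - (f \<circ> pos) ` e \<subseteq> inside (\<Union>((\<lambda>e. f ` A e) ` C))"
    if "e \<in> region_edges E pos A C D - C" for e
  proof -
    have "A e - pos ` e \<subseteq> D"
      using that by (auto simp: region_edges_def)
    then show ?thesis
      using D_in by auto
  qed
  ultimately have "plane_disc (region_verts V pos C D) (region_edges E pos A C D) (f \<circ> pos) (\<lambda>e. f ` A e) col C W"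
    using C by (auto simp: plane_disc_def region_verts_def)
  then show thesis
    by (rule that)
qed

section \<open>Counting edges\<close>

text \<open>The cases of one and two vertices make the induction over bridges go through.\<close>

definition edge_bound :: "'a set \<Rightarrow> 'a set set \<Rightarrow> bool" where
  "edge_bound V E \<longleftrightarrow>
     (1 \<le> card V \<longrightarrow> card E + 2 \<le> 2 * card V) \<and>
     (2 \<le> card V \<longrightarrow> card E + 3 \<le> 2 * card V) \<and>
     (3 \<le> card V \<longrightarrow> card E + 4 \<le> 2 * card V)"

context plane_bipartite
begin

lemma reachable_edge:
  assumes "F \<subseteq> E" "f \<in> F" "x \<in> f" "x \<in> reachable F a"
  shows "f \<subseteq> reachable F a"
proof -
  obtain u v where "f = {u, v}" "col u \<noteq> col v"
    using edge assms(1,2) by blast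
  then have "f = {x, u} \<and> x \<noteq> u \<or> f = {x, v} \<and> x \<noteq> v"
    using assms(3) by auto
  then show ?thesis
    using reachable_step[OF assms(4)] assms(2,4) by auto
qed

lemma reachable_subset:
  assumes "F \<subseteq> E" "a \<in> V"
  shows "reachable F a \<subseteq> V"
proof
  fix x
  assume "x \<in> reachable F a"
  then consider "x = a" | P X where "gpath F a x P X"
    by (auto simp: reachable_def)
  then show "x \<in> V"
  proof cases
    case 2
    then show ?thesis
      using gpath_facts(3,5,7)[OF 2] assms edge_subset by blast
  qed (use assms in simp)
qed

lemma boundary_edge_not_inside:
  assumes "C \<subseteq> E" "e \<in> C"
  shows "\<not> A e - pos ` e \<subseteq> inside (\<Union>(A ` C))"
  using edge_inner(2)[of e] inside_no_overlap[of "\<Union>(A ` C)"] assms by blast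

end

text \<open>The hypothesis \<open>gen\<close>, the bound for plane graphs with fewer than
  \<open>m\<close> edges, handles the components hanging on the cycle. The disc itself may have
  \<open>m\<close> edges, because \<open>gen\<close> is applied to proper subgraphs.\<close>

lemma disc_bound:
  assumes gen: "\<And>V' E'. plane_bipartite V' E' pos A col \<Longrightarrow> card E' < m \<Longrightarrow> edge_bound V' E'"
  shows "plane_disc V E pos A col C W \<Longrightarrow> card E \<le> m \<Longrightarrow> 2 * card E + card C + 4 \<le> 4 * card V"
proof (induction "card E" arbitrary: V E C W rule: less_induct)
  case less
  interpret plane_bipartite V E pos A col
    using less.prems(1) by (simp add: plane_disc_def)
  have cyc: "is_cycle E C W"
    and inV: "\<And>v. v \<in> V - W \<Longrightarrow> pos v \<in> inside (\<Union>(A ` C))"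
    and inE: "\<And>e. e \<in> E - C \<Longrightarrow> A e - pos ` e \<subseteq> inside (\<Union>(A ` C))"
    using less.prems(1) by (auto simp: plane_disc_def)
  note C = is_cycle_facts[OF cyc]
  have W: "W \<subseteq> V"
    using C edge_subset by blast
  show ?case
  proof (cases "\<exists>a b R Z. gpath (E - C) a b R Z \<and> a \<in> W \<and> b \<in> W")
    case True
    \<comment> \<open>After shortening, the path meets the cycle in its ends only and is thus a
      chord.\<close>
    then obtain a b R Z where R: "gpath (E - C) a b R Z" "a \<in> W" "b \<in> W" "Z \<inter> W = {a, b}"
      using shortest_connection by metis
    note Rf = gpath_facts[OF R(1)]
    obtain P X Q Y where PQ: "cycle_between E a b P X Q Y" "P \<union> Q = C" "X \<union> Y = W"
      using is_cycle_between[OF cyc R(2,3) Rf(6)] .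
    have PX: "gpath E a b P X" "gpath E a b Q Y" "X \<inter> Y = {a, b}" "P \<inter> Q = {}"
      using PQ(1) by (auto simp: cycle_between_def)
    note Pf = gpath_facts[OF PX(1)] and Qf = gpath_facts[OF PX(2)]
    have RE: "gpath E a b R Z"
      using gpath_mono[OF R(1)] by blast
    have RC: "R \<inter> C = {}" "R \<subseteq> E"
      using Rf by auto
    obtain r where r: "r \<in> R"
      using Rf by auto
    have "A r - pos ` r \<subseteq> inside (\<Union>(A ` C))" "A r - pos ` r \<noteq> {}"
      using inE[of r] edge_inner(2)[of r] r RC by auto
    then have meets: "\<Union>(A ` R) \<inter> inside (\<Union>(A ` C)) \<noteq> {}"
      using r by blast
    define D1 where "D1 = inside (\<Union>(A ` (P \<union> R)))"
    define D2 where "D2 = inside (\<Union>(A ` (Q \<union> R)))"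
    have split: "D1 \<inter> D2 = {}" "D1 \<union> D2 \<union> (\<Union>(A ` R) - {pos a, pos b}) = inside (\<Union>(A ` C))"
      using chord_splits_inside[OF PQ(1) RE] R(4) RC(1) meets PQ(2,3) by (auto simp: D1_def D2_def)
    have op: "open D1" "open D2"
      using compact_image[of "P \<union> R"] compact_image[of "Q \<union> R"] Pf(3) Qf(3) RC
      by (auto simp: D1_def D2_def intro!: open_inside compact_imp_closed)
    have cyc1: "is_cycle E (P \<union> R) (X \<union> Z)" and cyc2: "is_cycle E (Q \<union> R) (Y \<union> Z)"
    proof -
      have "X \<inter> Z = {a, b}" "Y \<inter> Z = {a, b}" "P \<inter> R = {}" "Q \<inter> R = {}"
        using R(4) RC PQ(2,3) Pf(4,5) Qf(4,5) by auto
      then show "is_cycle E (P \<union> R) (X \<union> Z)" "is_cycle E (Q \<union> R) (Y \<union> Z)"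
        using PX RE unfolding is_cycle_def cycle_between_def by blast+
    qed
    define V1 where "V1 = region_verts V pos (P \<union> R) D1"
    define V2 where "V2 = region_verts V pos (Q \<union> R) D2"
    define E1 where "E1 = region_edges E pos A (P \<union> R) D1"
    define E2 where "E2 = region_edges E pos A (Q \<union> R) D2"
    have disc1: "plane_disc V1 E1 pos A col (P \<union> R) (X \<union> Z)"
      and disc2: "plane_disc V2 E2 pos A col (Q \<union> R) (Y \<union> Z)"
      unfolding V1_def V2_def E1_def E2_def D1_def D2_def using region_disc cyc1 cyc2 by blast+
    have notin: "\<not> A e - pos ` e \<subseteq> D1" "\<not> A e - pos ` e \<subseteq> D2" if "e \<in> C" for e
      using boundary_edge_not_inside[OF C(1) that] split(2) by blast+
    have subE: "E1 \<subseteq> E" "E2 \<subseteq> E"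
      using Pf(3) Qf(3) RC by (auto simp: E1_def E2_def region_edges_def)
    \<comment> \<open>Each side loses the opposite arc of the cycle, which makes it a proper
      subgraph.\<close>
    have "Q \<inter> E1 = {}" "P \<inter> E2 = {}"
      using notin PX(4) RC PQ(2) by (auto simp: E1_def E2_def region_edges_def)
    then have "E1 \<subset> E" "E2 \<subset> E"
      using subE Pf(3,9) Qf(3,9) by blast+
    then have smaller: "card E1 < card E" "card E2 < card E"
      using finite_E psubset_card_mono by blast+
    have b1: "2 * card E1 + card (P \<union> R) + 4 \<le> 4 * card V1"
      using less.hyps[OF smaller(1) disc1] smaller less.prems(2) by simp
    have b2: "2 * card E2 + card (Q \<union> R) + 4 \<le> 4 * card V2"
      using less.hyps[OF smaller(2) disc2] smaller less.prems(2) by simp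
    have "E \<subseteq> E1 \<union> E2"
    proof
      fix e
      assume e: "e \<in> E"
      show "e \<in> E1 \<union> E2"
      proof (cases "e \<in> C \<union> R")
        case True
        then show ?thesis
          using PQ(2) by (auto simp: E1_def E2_def region_edges_def)
      next
        case False
        then have "A e - pos ` e \<subseteq> inside (\<Union>(A ` C))" "(A e - pos ` e) \<inter> \<Union>(A ` R) = {}"
          using inE[of e] e edge_inner_avoids_image[of e R] RC by auto
        then have "A e - pos ` e \<subseteq> D1 \<union> D2"
          unfolding split(2)[symmetric] by blast
        then show ?thesis
          using edge_inner_side[OF e _ op split(1)] e by (auto simp: E1_def E2_def region_edges_def)
      qed
    qed
    then have E_eq: "E1 \<union> E2 = E"
      using subE by blast
    have V1: "V1 = X \<union> Z \<union> {v \<in> V. pos v \<in> D1}" and V2: "V2 = Y \<union> Z \<union> {v \<in> V. pos v \<in> D2}"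
      using Pf(7) Qf(7) Rf(7) by (auto simp: V1_def V2_def region_verts_def)
    have Z: "Z \<subseteq> V"
      using Rf(3,7) edge_subset by blast
    have "V \<subseteq> V1 \<union> V2"
    proof
      fix v
      assume v: "v \<in> V"
      show "v \<in> V1 \<union> V2"
      proof (cases "v \<in> W \<union> Z")
        case True
        then show ?thesis
          using V1 V2 PQ(3) by auto
      next
        case False
        then have "pos v \<in> inside (\<Union>(A ` C))" "pos v \<notin> \<Union>(A ` R)"
          using inV v vertex_on_image[OF RC(2) v] Rf(7) by auto
        then have "pos v \<in> D1 \<union> D2"
          using split(2) by blast
        then show ?thesis
          using V1 V2 v by auto
      qed
    qed
    then have V_eq: "V1 \<union> V2 = V"
      using V1 V2 Z W PQ(3) by auto
    have on_C: "pos v \<notin> D1 \<union> D2" if "v \<in> W" for v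
    proof -
      have "pos v \<in> \<Union>(A ` C)"
        using that C(1,3) endpoint_in_edge by blast
      then show ?thesis
        using split(2) inside_no_overlap[of "\<Union>(A ` C)"] by blast
    qed
    \<comment> \<open>Vertices of the cycle lie in neither \<open>D1\<close> nor \<open>D2\<close>,
      these sets are disjoint, and \<open>X\<close> and \<open>Y\<close> share only the ends of the
      chord.\<close>
    have "V1 \<inter> V2 \<subseteq> Z"
    proof
      fix v
      assume "v \<in> V1 \<inter> V2"
      then have "v \<in> Z \<or> v \<in> X \<inter> Y \<or> v \<in> X \<union> Y \<and> pos v \<in> D1 \<union> D2 \<or> pos v \<in> D1 \<inter> D2"
        by (auto simp: V1 V2)
      then show "v \<in> Z"
        using on_C[of v] Rf(4,5) unfolding split(1) PQ(3) PX(3) by auto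
    qed
    then have "card (V1 \<inter> V2) \<le> card Z"
      using Rf(2) card_mono by blast
    moreover have "card V1 + card V2 = card V + card (V1 \<inter> V2)"
      using card_Un_Int[of V1 V2] V_eq finite_V by (metis finite_Un)
    \<comment> \<open>The \<open>1\<close> arises because the path has one vertex more than
      edges.\<close>
    ultimately have cV: "card V1 + card V2 \<le> card V + card R + 1"
      using Rf(8) by simp
    have "R \<subseteq> E1 \<inter> E2"
      by (auto simp: E1_def E2_def region_edges_def)
    then have "card R \<le> card (E1 \<inter> E2)"
      using finite_E subE by (meson card_mono finite_Int finite_subset)
    moreover have "card E1 + card E2 = card E + card (E1 \<inter> E2)"
      using card_Un_Int[of E1 E2] E_eq finite_E by (metis finite_Un)
    ultimately have cE: "card E + card R \<le> card E1 + card E2"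
      by simp
    have "card (P \<union> R) = card P + card R" "card (Q \<union> R) = card Q + card R" "card C = card P + card Q"
      using PX(4) RC(1) PQ(2) Pf(1) Qf(1) Rf(1) by (auto intro!: card_Un_disjoint)
    \<comment> \<open>In the sum of both bounds the chord counts \<open>2 * card R\<close> as shared
      edges and \<open>2 * card R\<close> in the two cycle lengths, against
      \<open>4 * card R\<close> for shared vertices. The constants \<open>8\<close> and
      \<open>4\<close> leave \<open>4\<close>.\<close>
    then show ?thesis
      using b1 b2 cV cE by linarith
  next
    case no_chord: False
    show ?thesis
    proof (cases "E = C")
      case True
      \<comment> \<open>For a bare cycle of length \<open>c\<close> the claim is
        \<open>3 * c + 4 \<le> 4 * card V\<close>, which follows from \<open>c \<le> card V\<close>
        and \<open>4 \<le> c\<close>.\<close>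
      then show ?thesis
        using bipartite_cycle_length[OF cyc, of col] col_differs C(6) card_mono[OF finite_V W] by simp
    next
      case False
      then obtain e where e: "e \<in> E - C"
        using C(1) by blast
      then obtain p q where pq: "e = {p, q}" "p \<in> V"
        using edge by blast
      \<comment> \<open>\<open>K\<close> is a component of what remains without the cycle edges, and
        \<open>F\<close> consists of its edges.\<close>
      define K where "K = reachable (E - C) p"
      define F where "F = {f \<in> E - C. f \<subseteq> K}"
      have K: "K \<subseteq> V" "p \<in> K"
        using reachable_subset[of "E - C" p] pq reachable_self by (auto simp: K_def)
      have closed: "f \<subseteq> K" if "f \<in> E - C" "f \<inter> K \<noteq> {}" for f
        using reachable_edge[of "E - C" f] that by (auto simp: K_def)
      have "e \<in> F"
        using e closed[of e] pq K by (auto simp: F_def)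
      \<comment> \<open>Two vertices of the cycle in \<open>K\<close> would be joined by a path that
        the case assumption excludes.\<close>
      have "x = y" if "x \<in> K \<inter> W" "y \<in> K \<inter> W" for x y
        using reachable_connected[of x "E - C" p y] that no_chord unfolding K_def by blast
      then have "card (K \<inter> W) \<le> Suc 0"
        using card_le_Suc0_iff_eq[of "K \<inter> W"] C(5) by blast
      then have cK: "card K \<le> card (K - W) + 1"
        using card_Diff_subset_Int[of K W] C(5) by simp
      have finK: "finite K"
        using K finite_V finite_subset by blast
      have "plane_bipartite K F pos A col"
        using K by (intro subgraph) (auto simp: F_def)
      moreover have "F \<subset> E"
        using C(1,2) by (auto simp: F_def)
      then have "card F < card E"
        using finite_E psubset_card_mono by blast
      ultimately have "edge_bound K F"
        using gen less.prems(2) by simp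
      moreover have "1 \<le> card K"
        using K(2) finK by (simp add: Suc_le_eq card_gt_0_iff) blast
      \<comment> \<open>With \<open>cK\<close> this yields
        \<open>card F \<le> 2 * card (K - W)\<close>, so putting \<open>F\<close> and
        \<open>K - W\<close> back adds no more to the left side of the claim than to the right
        side.\<close>
      ultimately have bF: "card F + 2 \<le> 2 * card K"
        by (simp add: edge_bound_def)
      have "plane_disc (V - (K - W)) (E - F) pos A col C W"
      proof -
        have "plane_bipartite (V - (K - W)) (E - F) pos A col"
        proof (rule subgraph)
          fix f
          assume f: "f \<in> E - F"
          show "f \<subseteq> V - (K - W)"
          proof (cases "f \<in> C")
            case True
            then show ?thesis
              using C(3) W by blast
          next
            case False
            then have "f \<inter> K = {}"
              using closed[of f] f by (auto simp: F_def)
            then show ?thesis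
              using f edge_subset by blast
          qed
        qed auto
        moreover have "is_cycle (E - F) C W"
          by (rule is_cycle_restrict[OF cyc]) (use C(1) in \<open>auto simp: F_def\<close>)
        ultimately show ?thesis
          using inV inE by (auto simp: plane_disc_def)
      qed
      moreover have cEF: "card (E - F) + card F = card E"
        using \<open>F \<subset> E\<close> finite_E by (metis add.commute card_Diff_subset card_mono finite_subset le_add_diff_inverse psubsetE)
      moreover have "card F > 0"
        using \<open>e \<in> F\<close> \<open>F \<subset> E\<close> finite_E by (metis card_gt_0_iff empty_iff finite_subset psubsetE)
      ultimately have "2 * card (E - F) + card C + 4 \<le> 4 * card (V - (K - W))"
        using less.hyps less.prems(2) by simp
      moreover have "card (V - (K - W)) + card (K - W) = card V"
        using K(1) finite_V finK by (metis Diff_subset add.commute card_Diff_subset card_mono finite_Diff le_add_diff_inverse subset_trans)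
      ultimately show ?thesis
        using bF cK cEF by linarith
    qed
  qed
qed

text \<open>\<open>pos\<close> and \<open>A\<close> vary in the induction because the outside of a
  cycle is redrawn by inversion. The cases are whether a chosen edge lies on a cycle or is a
  bridge.\<close>

lemma plane_bipartite_edge_bound: "plane_bipartite V E pos A col \<Longrightarrow> edge_bound V E"
proof (induction "card E" arbitrary: V E pos A rule: less_induct)
  case less
  interpret plane_bipartite V E pos A col
    by (rule less.prems)
  show ?case
  proof (cases "E = {}")
    case True
    then show ?thesis
      by (auto simp: edge_bound_def)
  next
    case False
    then obtain e where "e \<in> E"
      by blast
    then obtain u v where e: "{u, v} \<in> E" "u \<in> V" "v \<in> V" "u \<noteq> v"
      using edge by metis
    define F where "F = E - {{u, v}}"
    show ?thesis
    proof (cases "v \<in> reachable F u")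
      case True
      then obtain P X where P: "gpath F u v P X"
        using e by (auto simp: reachable_def)
      define C where "C = P \<union> {{u, v}}"
      define W where "W = X \<union> {u, v}"
      have "gpath E u v P X"
        using P by (rule gpath_mono) (auto simp: F_def)
      then have "cycle_between E u v P X {{u, v}} {u, v}"
        using gpath.single[OF e(1,4)] gpath_facts(3,4,5)[OF P] by (auto simp: cycle_between_def F_def)
      then have cyc: "is_cycle E C W"
        unfolding is_cycle_def C_def W_def by blast
      note C = is_cycle_facts[OF cyc]
      define D1 where "D1 = inside (\<Union>(A ` C))"
      define D2 where "D2 = outside (\<Union>(A ` C))"
      define V1 where "V1 = region_verts V pos C D1"
      define V2 where "V2 = region_verts V pos C D2"
      define E1 where "E1 = region_edges E pos A C D1"
      define E2 where "E2 = region_edges E pos A C D2"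
      have D: "D1 \<inter> D2 = {}" "D1 \<union> D2 = - \<Union>(A ` C)"
        unfolding D1_def D2_def by (rule inside_Int_outside, rule inside_Un_outside)
      have op: "open D1" "open D2"
        using compact_image[OF C(1)]
        by (auto simp: D1_def D2_def intro!: open_inside open_outside compact_imp_closed)
      have subE: "E1 \<subseteq> E" "E2 \<subseteq> E" "C \<subseteq> E1 \<inter> E2"
        using C(1) by (auto simp: E1_def E2_def region_edges_def)
      then have cE12: "card E1 \<le> card E" "card E2 \<le> card E"
        using finite_E card_mono by blast+
      \<comment> \<open>\<open>E1\<close> may be all of \<open>E\<close>; taking
        \<open>m = card E\<close> in \<open>disc_bound\<close> covers this, and its hypothesis still
        concerns strictly fewer edges.\<close>
      have b1: "2 * card E1 + card C + 4 \<le> 4 * card V1"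
      proof (rule disc_bound)
        show "plane_disc V1 E1 pos A col C W"
          unfolding V1_def E1_def D1_def by (rule region_disc[OF cyc])
        show "edge_bound V' E'" if "plane_bipartite V' E' pos A col" "card E' < card E" for V' E'
          using less.hyps that by blast
      qed (rule cE12)
      obtain pos' A' where "plane_disc V2 E2 pos' A' col C W"
        unfolding V2_def E2_def D2_def by (rule region_outside_disc[OF cyc])
      then have b2: "2 * card E2 + card C + 4 \<le> 4 * card V2"
      proof (rule disc_bound[rotated])
        show "edge_bound V' E'" if "plane_bipartite V' E' pos' A' col" "card E' < card E" for V' E'
          using less.hyps that by blast
      qed (rule cE12)
      have "E \<subseteq> E1 \<union> E2"
      proof
        fix f
        assume f: "f \<in> E"
        show "f \<in> E1 \<union> E2"
        proof (cases "f \<in> C")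
          case True
          then show ?thesis
            by (auto simp: E1_def region_edges_def)
        next
          case False
          then have "A f - pos ` f \<subseteq> D1 \<union> D2"
            using edge_inner_avoids_image[OF f C(1)] D(2) by blast
          then show ?thesis
            using edge_inner_side[OF f _ op D(1)] f by (auto simp: E1_def E2_def region_edges_def)
        qed
      qed
      then have "E1 \<union> E2 = E"
        using subE by blast
      then have "card E1 + card E2 = card E + card (E1 \<inter> E2)"
        using card_Un_Int[of E1 E2] finite_E by (metis finite_Un)
      moreover have "card C \<le> card (E1 \<inter> E2)"
        using subE finite_E by (meson card_mono finite_Int finite_subset)
      ultimately have cE: "card E + card C \<le> card E1 + card E2"
        by simp
      have VV: "V1 = W \<union> {v \<in> V. pos v \<in> D1}" "V2 = W \<union> {v \<in> V. pos v \<in> D2}"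
        using C(3) by (auto simp: V1_def V2_def region_verts_def)
      have "W \<subseteq> V"
        using C(1,3) edge_subset by blast
      moreover have "v \<in> W \<or> pos v \<in> D1 \<union> D2" if "v \<in> V" for v
        using vertex_on_image[OF C(1) that] C(3) D(2) by blast
      ultimately have "V1 \<union> V2 = V"
        unfolding VV by blast
      then have "card V1 + card V2 = card V + card (V1 \<inter> V2)"
        using card_Un_Int[of V1 V2] finite_V by (metis finite_Un)
      moreover have "V1 \<inter> V2 \<subseteq> W"
        unfolding VV using D(1) by blast
      then have "card (V1 \<inter> V2) \<le> card W"
        using C(5) card_mono by blast
      ultimately have "card V1 + card V2 \<le> card V + card C"
        using C(6) by simp
      \<comment> \<open>The cycle is shared by both parts: \<open>2 * c\<close> from the edges and
        \<open>2 * c\<close> from the two lengths cancel \<open>4 * c\<close> from the vertices,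
        leaving twice the claim.\<close>
      then have "card E + 4 \<le> 2 * card V"
        using b1 b2 cE by linarith
      then show ?thesis
        by (simp add: edge_bound_def)
    next
      case False
      \<comment> \<open>Now \<open>{u, v}\<close> is a bridge: \<open>v\<close> lies in
        \<open>V - K\<close>, and no edge of \<open>F\<close> runs between \<open>K\<close> and
        \<open>V - K\<close>.\<close>
      define K where "K = reachable F u"
      have K: "K \<subseteq> V" "u \<in> K" "v \<notin> K"
        using reachable_subset[of F u] e False reachable_self by (auto simp: K_def F_def)
      have closed: "f \<subseteq> K" if "f \<in> F" "f \<inter> K \<noteq> {}" for f
        using reachable_edge[of F f] that by (auto simp: K_def F_def)
      define E1 where "E1 = {f \<in> F. f \<subseteq> K}"
      define E2 where "E2 = {f \<in> F. f \<subseteq> V - K}"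
      have sub: "E1 \<subset> E" "E2 \<subset> E"
        using e(1) by (auto simp: E1_def E2_def F_def)
      then have "card E1 < card E" "card E2 < card E"
        using finite_E psubset_card_mono by blast+
      moreover have "plane_bipartite K E1 pos A col" "plane_bipartite (V - K) E2 pos A col"
        using K sub by (auto intro!: subgraph simp: E1_def E2_def)
      ultimately have b: "edge_bound K E1" "edge_bound (V - K) E2"
        using less.hyps by blast+
      have "E \<subseteq> {{u, v}} \<union> (E1 \<union> E2)"
      proof
        fix f
        assume f: "f \<in> E"
        show "f \<in> {{u, v}} \<union> (E1 \<union> E2)"
          using closed[of f] edge_subset[OF f] f by (auto simp: E1_def E2_def F_def)
      qed
      then have "card E \<le> card ({{u, v}} \<union> (E1 \<union> E2))"
        using sub finite_E by (intro card_mono) (auto intro: finite_subset)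
      also have "\<dots> \<le> card {{u, v}} + (card E1 + card E2)"
        using card_Un_le[of "{{u, v}}" "E1 \<union> E2"] card_Un_le[of E1 E2] by linarith
      finally have cE: "card E \<le> 1 + card E1 + card E2"
        by simp
      have fin: "finite K" "finite (V - K)"
        using K finite_V finite_subset by auto
      have "card K \<ge> 1" "card (V - K) \<ge> 1"
        using K e fin by (auto simp: Suc_le_eq card_gt_0_iff)
      moreover have "card V = card K + card (V - K)"
        using K fin by (metis Un_Diff_cancel Diff_disjoint card_Un_disjoint sup.absorb2)
      \<comment> \<open>Two one-vertex sides give at most one edge, the bound for two vertices. One
        vertex against \<open>k \<ge> 2\<close> gives
        \<open>1 + 0 + (2 * k - 3) = 2 * (k + 1) - 4\<close>. Larger sides leave slack.\<close>
      ultimately show ?thesis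
        using b cE unfolding edge_bound_def by linarith
    qed
  qed
qed

section \<open>From IC-planar graphs to plane graphs\<close>

theorem theorem2:
  fixes V :: "'a set" and E :: "'a set set" and n :: nat
  assumes "n \<ge> 3"
    and "simple_graph V E"
    and "card V = n"
    and "bipartite V E"
    and "ic_planar V E"
  shows "real (card E) \<le> 2.25 * real n - 4"
proof -
  obtain pos \<gamma> where draw: "topological_drawing V E pos \<gamma>"
    and indep: "\<forall>e f g h. crossing_pair E \<gamma> e f \<longrightarrow> crossing_pair E \<gamma> g h \<longrightarrow> {e, f} \<noteq> {g, h} \<longrightarrow>
      (e \<union> f) \<inter> (g \<union> h) = {}"
    using assms(5) unfolding ic_planar_def by (elim exE conjE) (rule that)
  interpret topological_drawing V E pos \<gamma>
    by (rule draw)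
  obtain S T where ST: "S \<union> T = V" "S \<inter> T = {}" "\<forall>e\<in>E. \<exists>a\<in>S. \<exists>b\<in>T. e = {a, b}"
    using assms(4) unfolding bipartite_def by (elim exE conjE) (rule that)
  have finV: "finite V" and Esub: "\<And>e. e \<in> E \<Longrightarrow> e \<subseteq> V" and Ecard: "\<And>e. e \<in> E \<Longrightarrow> card e = 2"
    using assms(2) by (auto simp: simple_graph_def)
  have finE: "finite E"
    using finV Esub by (auto intro: finite_subset[of E "Pow V"])
  \<comment> \<open>Pairs are unordered, so that a crossing is not counted once for each order of
    its edges.\<close>
  define M where "M = {{e, f} | e f. crossing_pair E \<gamma> e f}"
  have "M \<subseteq> Pow E"
    by (auto simp: M_def crossing_pair_def)
  then have finM: "finite M"
    using finE finite_subset by blast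
  have "card (\<Union>m) = 4" "\<Union>m \<subseteq> V" if mM: "m \<in> M" for m
  proof -
    obtain e f where m: "m = {e, f}" "crossing_pair E \<gamma> e f"
      using mM by (auto simp: M_def)
    \<comment> \<open>Adjacent edges do not cross, so a crossing pair covers four distinct
      vertices.\<close>
    then have ef: "e \<in> E" "f \<in> E" "e \<inter> f = {}"
      using adjacent_no_crossing unfolding crossing_pair_def by blast+
    then have "finite e" "finite f"
      using Ecard by (metis card.infinite zero_neq_numeral)+
    then show "card (\<Union>m) = 4" "\<Union>m \<subseteq> V"
      using m ef Ecard Esub by (auto simp: card_Un_disjoint)
  qed
  note m = this
  have "card (\<Union>m\<in>M. \<Union>m) = (\<Sum>m\<in>M. card (\<Union>m))"
  proof (rule card_UN_disjoint[OF finM])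
    show "\<forall>m\<in>M. finite (\<Union>m)"
      using m(2) finV finite_subset by blast
    show "\<forall>m\<in>M. \<forall>m'\<in>M. m \<noteq> m' \<longrightarrow> \<Union>m \<inter> \<Union>m' = {}"
    proof (intro ballI impI)
      fix m m'
      assume ne: "m \<in> M" "m' \<in> M" "m \<noteq> m'"
      obtain e f where "m = {e, f}" "crossing_pair E \<gamma> e f"
        using ne(1) by (auto simp: M_def)
      moreover obtain g h where "m' = {g, h}" "crossing_pair E \<gamma> g h"
        using ne(2) by (auto simp: M_def)
      moreover note ne(3)
      ultimately show "\<Union>m \<inter> \<Union>m' = {}"
        using indep by simp
    qed
  qed
  also have "\<dots> = 4 * card M"
    using m(1) by simp
  finally have "4 * card M \<le> n"
    using card_mono[OF finV, of "\<Union>m\<in>M. \<Union>m"] m(2) assms(3) by (simp add: UN_subset_iff)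
  \<comment> \<open>One edge is picked from every crossing pair; which one is irrelevant.\<close>
  define R where "R = (\<lambda>m. SOME e. e \<in> m) ` M"
  have R: "(SOME e. e \<in> m) \<in> m" if "m \<in> M" for m
  proof -
    have "m \<noteq> {}"
      using that by (auto simp: M_def)
    then show ?thesis
      by (simp add: some_in_eq)
  qed
  have "card R \<le> card M"
    unfolding R_def by (rule card_image_le[OF finM])
  define F where "F = E - R"
  \<comment> \<open>A common inner point is a crossing, so \<open>{e, f}\<close> is in
    \<open>M\<close> and one of the two edges was put into \<open>R\<close>.\<close>
  have uncrossed: "path_inner (\<gamma> e) \<inter> path_inner (\<gamma> f) = {}" if "e \<in> F" "f \<in> F" "e \<noteq> f" for e f
  proof (rule ccontr)
    assume "path_inner (\<gamma> e) \<inter> path_inner (\<gamma> f) \<noteq> {}"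
    then have "crossing_pair E \<gamma> e f"
      using no_tangential_meeting that unfolding crossing_pair_def F_def by blast
    then have "{e, f} \<in> M"
      by (auto simp: M_def)
    then obtain g where "g \<in> R" "g \<in> {e, f}"
      using R unfolding R_def by blast
    then show False
      using that by (auto simp: F_def)
  qed
  have "plane_bipartite V F pos (\<lambda>e. path_image (\<gamma> e)) (\<lambda>v. v \<in> S)"
  proof
    show "finite V" "inj_on pos V"
      using finV vertices_distinct by auto
    show "\<exists>u\<in>V. \<exists>v\<in>V. e = {u, v} \<and> (u \<in> S) \<noteq> (v \<in> S)" if e: "e \<in> F" for e
    proof -
      obtain a b where "a \<in> S" "b \<in> T" "e = {a, b}"
        using ST(3) e unfolding F_def by blast
      moreover from this have "a \<in> V" "b \<in> V" "b \<notin> S"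
        using ST(1,2) by auto
      ultimately show ?thesis
        by blast
    qed
    show "\<exists>g. arc g \<and> path_image g = path_image (\<gamma> e) \<and> {pathstart g, pathfinish g} = pos ` e"
      if "e \<in> F" for e
      using edge_arc[of e] edge_ends[of e] that unfolding F_def by blast
    show on_edge: "v \<in> e" if "e \<in> F" "v \<in> V" "pos v \<in> path_image (\<gamma> e)" for e v
      using edge_avoids_vertices[of e v] that unfolding F_def by blast
    show "path_image (\<gamma> e) \<inter> path_image (\<gamma> f) \<subseteq> pos ` (e \<inter> f)" if "e \<in> F" "f \<in> F" "e \<noteq> f" for e f
    proof
      fix z
      assume z: "z \<in> path_image (\<gamma> e) \<inter> path_image (\<gamma> f)"
      have ends: "{pathstart (\<gamma> e), pathfinish (\<gamma> e)} = pos ` e" "{pathstart (\<gamma> f), pathfinish (\<gamma> f)} = pos ` f"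
        using edge_ends that unfolding F_def by blast+
      \<comment> \<open>A common point is not inner to both arcs, so it is an end of one; as edges
        avoid foreign vertices, it is an end of the other too.\<close>
      have "z \<in> pos ` e \<union> pos ` f"
        using uncrossed[OF that] z unfolding path_inner_def ends by blast
      then obtain v where v: "v \<in> e \<union> f" "z = pos v"
        by blast
      then have "v \<in> V"
        using Esub that unfolding F_def by blast
      then have "v \<in> e \<inter> f"
        using on_edge that z v by blast
      then show "z \<in> pos ` (e \<inter> f)"
        using v by blast
    qed
  qed
  then have "card F + 4 \<le> 2 * n"
    using plane_bipartite_edge_bound[of V F] assms(1,3) by (auto simp: edge_bound_def)
  moreover have "card E \<le> card F + card M"
  proof -
    have "card E \<le> card F + card R"
      using diff_card_le_card_Diff[of R E] finM by (simp add: F_def R_def)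
    then show ?thesis
      using \<open>card R \<le> card M\<close> by simp
  qed
  \<comment> \<open>Four times the sum of the bounds \<open>2 * n - 4\<close> for \<open>F\<close>
    and \<open>n / 4\<close> for \<open>M\<close>, kept in the natural numbers.\<close>
  ultimately have "4 * card E + 16 \<le> 9 * n"
    using \<open>4 * card M \<le> n\<close> by linarith
  then have "real (4 * card E + 16) \<le> real (9 * n)"
    using of_nat_le_iff by blast
  then show ?thesis
    by simp
qed

end
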